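(* The class of (countably infinite) binary successor trees is not punctually robust: there is a computable binary successor tree not isomorphic to any punctual binary successor tree.
   Context: A binary successor tree is a structure $\mathcal T=(T,S^1,S^2,e,r)$ with unary functions $S^1,S^2$ and constants $e$ (the empty node) and $r$ (the root) such that: (1) $S^1$ and $S^2$ have no cycles and each $S^i$ is injective on $T\setminus (S^i)^{-1}(e)$; (2) $\mathrm{ran}(S^1)\cap\mathrm{ran}(S^2)=\{e\}$; (3) $\mathrm{ran}(S^1)\cup\mathrm{ran}(S^2)=T\setminus\{r\}$; (4) $S^1(e)=S^2(e)=e$. A structure is computable if its domain is a computable subset of $\mathbb N$ and its functions are computable; it is punctual if its domain is $\mathbb N$ and its functions are primitive recursive. A class is punctually robust if every computable member is isomorphic to a punctual structure. *)

theory Defs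
  imports Main
begin

section \<open>Recursive functions\<close>

text \<open>
  Codes for the partial recursive functions on tuples of natural numbers. Arities are not recorded
  in the codes: a code denotes one partial function on tuples of length \<open>k\<close> for each \<open>k\<close>
  (nowhere defined if the arities do not fit).
\<close>

datatype recf =
    Zero
  | Succ
  | Proj nat
  | Comp recf "recf list"
  | PrimRec recf recf
  | Mu recf

inductive rec_eval :: "recf \<Rightarrow> nat list \<Rightarrow> nat \<Rightarrow> bool" where
  Zero: "rec_eval Zero xs 0"
| Succ: "rec_eval Succ [x] (Suc x)"
| Proj: "i < length xs \<Longrightarrow> rec_eval (Proj i) xs (xs ! i)"
| Comp: "list_all2 (\<lambda>g y. rec_eval g xs y) gs ys \<Longrightarrow> rec_eval f ys z \<Longrightarrow>
    rec_eval (Comp f gs) xs z"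
| PrimRec_0: "rec_eval f xs z \<Longrightarrow> rec_eval (PrimRec f g) (0 # xs) z"
| PrimRec_Suc: "rec_eval (PrimRec f g) (n # xs) y \<Longrightarrow> rec_eval g (n # y # xs) z \<Longrightarrow>
    rec_eval (PrimRec f g) (Suc n # xs) z"
| Mu: "rec_eval f (n # xs) 0 \<Longrightarrow> (\<forall>m<n. \<exists>k. rec_eval f (m # xs) (Suc k)) \<Longrightarrow>
    rec_eval (Mu f) xs n"

inductive_cases rec_eval_ZeroE: "rec_eval Zero xs z"
inductive_cases rec_eval_SuccE: "rec_eval Succ xs z"
inductive_cases rec_eval_ProjE: "rec_eval (Proj i) xs z"
inductive_cases rec_eval_CompE: "rec_eval (Comp f gs) xs z"
inductive_cases rec_eval_PrimRec_0E: "rec_eval (PrimRec f g) (0 # xs) z"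
inductive_cases rec_eval_PrimRec_SucE: "rec_eval (PrimRec f g) (Suc n # xs) z"
inductive_cases rec_eval_MuE: "rec_eval (Mu f) xs z"

lemma rec_eval_deterministic:
  "rec_eval p xs y \<Longrightarrow> rec_eval p xs z \<Longrightarrow> y = z"
proof (induction arbitrary: z rule: rec_eval.induct)
  case (Zero xs)
  then show ?case by (auto elim: rec_eval_ZeroE)
next
  case (Succ x)
  then show ?case by (auto elim: rec_eval_SuccE)
next
  case (Proj i xs)
  from Proj.prems show ?case by (auto elim: rec_eval_ProjE)
next
  case (Comp xs gs ys f y)
  from Comp.prems obtain ys' where ys': "list_all2 (\<lambda>g y. rec_eval g xs y) gs ys'"
    and z: "rec_eval f ys' z"
    by (auto elim: rec_eval_CompE)
  have "ys = ys'"
    using Comp.IH(1) ys' by (auto simp: list_all2_conv_all_nth intro!: nth_equalityI)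
  then show ?case using Comp.IH(2) z by blast
next
  case (PrimRec_0 f xs y g)
  from PrimRec_0.prems PrimRec_0.IH show ?case by (auto elim: rec_eval_PrimRec_0E)
next
  case (PrimRec_Suc f g n xs y w)
  from PrimRec_Suc.prems obtain y' where "rec_eval (PrimRec f g) (n # xs) y'"
    and "rec_eval g (n # y' # xs) z"
    by (auto elim: rec_eval_PrimRec_SucE)
  then show ?case using PrimRec_Suc.IH by blast
next
  case (Mu f n xs)
  from Mu.prems have z: "rec_eval f (z # xs) 0" "\<forall>m<z. \<exists>k. rec_eval f (m # xs) (Suc k)"
    by (auto elim: rec_eval_MuE)
  show ?case
  proof (rule linorder_cases[of n z])
    assume "n < z"
    then obtain k where "rec_eval f (n # xs) (Suc k)" using z by blast
    then show ?thesis using Mu.IH(1) by blast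
  next
    assume "z < n"
    then obtain k where "\<forall>w. rec_eval f (z # xs) w \<longrightarrow> Suc k = w" using Mu.IH by blast
    then show ?thesis using z(1) by blast
  qed
qed

fun mu_free :: "recf \<Rightarrow> bool" where
  "mu_free Zero \<longleftrightarrow> True"
| "mu_free Succ \<longleftrightarrow> True"
| "mu_free (Proj i) \<longleftrightarrow> True"
| "mu_free (Comp f gs) \<longleftrightarrow> mu_free f \<and> (\<forall>g\<in>set gs. mu_free g)"
| "mu_free (PrimRec f g) \<longleftrightarrow> mu_free f \<and> mu_free g"
| "mu_free (Mu f) \<longleftrightarrow> False"

text \<open>
  For \<open>D = UNIV\<close> this is computability of a total function; in general \<open>f\<close> agrees on \<open>D\<close> with a
  partial recursive function. For a computable set \<open>D\<close>, this is equivalent to partial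
  recursiveness of the restriction of \<open>f\<close> to \<open>D\<close>.
\<close>

definition computable_on :: "nat set \<Rightarrow> (nat \<Rightarrow> nat) \<Rightarrow> bool" where
  "computable_on D f \<longleftrightarrow> (\<exists>p. \<forall>x\<in>D. rec_eval p [x] (f x))"

definition computable_set :: "nat set \<Rightarrow> bool" where
  "computable_set D \<longleftrightarrow> computable_on UNIV (\<lambda>x. if x \<in> D then 1 else 0)"

definition primitive_recursive :: "(nat \<Rightarrow> nat) \<Rightarrow> bool" where
  "primitive_recursive f \<longleftrightarrow> (\<exists>p. mu_free p \<and> (\<forall>x. rec_eval p [x] (f x)))"

section \<open>Structures with two unary functions and two constants\<close>

text \<open>Only the values of \<open>succ1\<close> and \<open>succ2\<close> on the domain \<open>nodes\<close> are part of the structure.\<close>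

record 'a succ_structure =
  nodes :: "'a set"
  succ1 :: "'a \<Rightarrow> 'a"
  succ2 :: "'a \<Rightarrow> 'a"
  empty_node :: 'a
  root :: 'a

definition wf_structure :: "'a succ_structure \<Rightarrow> bool" where
  "wf_structure A \<longleftrightarrow>
     succ1 A ` nodes A \<subseteq> nodes A \<and> succ2 A ` nodes A \<subseteq> nodes A \<and>
     empty_node A \<in> nodes A \<and> root A \<in> nodes A"

definition isomorphic :: "'a succ_structure \<Rightarrow> 'b succ_structure \<Rightarrow> bool" where
  "isomorphic A B \<longleftrightarrow> (\<exists>h. bij_betw h (nodes A) (nodes B) \<and>
     (\<forall>x\<in>nodes A. h (succ1 A x) = succ1 B (h x)) \<and>
     (\<forall>x\<in>nodes A. h (succ2 A x) = succ2 B (h x)) \<and>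
     h (empty_node A) = empty_node B \<and> h (root A) = root B)"

definition computable_structure :: "nat succ_structure \<Rightarrow> bool" where
  "computable_structure A \<longleftrightarrow> wf_structure A \<and> computable_set (nodes A) \<and>
     computable_on (nodes A) (succ1 A) \<and> computable_on (nodes A) (succ2 A)"

definition punctual :: "nat succ_structure \<Rightarrow> bool" where
  "punctual A \<longleftrightarrow> wf_structure A \<and> nodes A = UNIV \<and>
     primitive_recursive (succ1 A) \<and> primitive_recursive (succ2 A)"

text \<open>
  A class of countable structures is represented by its members with domain a set of natural
  numbers; all computable and all punctual structures are of this form.
\<close>

definition punctually_robust :: "nat succ_structure set \<Rightarrow> bool" where
  "punctually_robust K \<longleftrightarrow>
     (\<forall>A\<in>K. computable_structure A \<longrightarrow> (\<exists>B. punctual B \<and> isomorphic A B))"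

section \<open>Binary successor trees\<close>

definition child_rel :: "'a succ_structure \<Rightarrow> ('a \<times> 'a) set" where
  "child_rel A = {(x, succ1 A x) | x. x \<in> nodes A} \<union> {(x, succ2 A x) | x. x \<in> nodes A}"

text \<open>
  The loops at the empty node, which are forced by the last condition, do not count as cycles.
  Cycles mixing both successor functions are excluded as well.
\<close>

definition binary_successor_tree :: "'a succ_structure \<Rightarrow> bool" where
  "binary_successor_tree A \<longleftrightarrow> wf_structure A \<and>
     (\<forall>x\<in>nodes A - {empty_node A}. (x, x) \<notin> (child_rel A)\<^sup>+) \<and>
     inj_on (succ1 A) (nodes A - {x \<in> nodes A. succ1 A x = empty_node A}) \<and>
     inj_on (succ2 A) (nodes A - {x \<in> nodes A. succ2 A x = empty_node A}) \<and>
     succ1 A ` nodes A \<inter> succ2 A ` nodes A = {empty_node A} \<and>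
     succ1 A ` nodes A \<union> succ2 A ` nodes A = nodes A - {root A} \<and>
     succ1 A (empty_node A) = empty_node A \<and> succ2 A (empty_node A) = empty_node A"

end

theory Submission
  imports Defs "HOL-Library.Nat_Bijection"
begin

text \<open>
  Let \<open>A\<close> be a computable set that is not primitive recursive, and take the tree consisting of an
  infinite \<open>S\<^sup>1\<close>-spine in which the \<open>n\<close>-th spine node has a leaf as its \<open>S\<^sup>2\<close>-successor iff \<open>n \<in> A\<close>.
  It is computable, and in a punctual copy \<open>A\<close> could be decided primitive recursively by testing
  \<open>S\<^sup>2((S\<^sup>1)\<^sup>n(r)) \<noteq> e\<close>.

  The set \<open>A\<close> is obtained by diagonalisation against a language of unary functions built from
  pairing, composition and iteration. Every natural number is a program of this language and every
  program terminates on every input, so the diagonal is total; a stack machine evaluating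
  the programs provides its computability.
\<close>

section \<open>Closure properties of recursive functions\<close>

text \<open>Only lists of length \<open>k\<close> matter, which fixes the arity that codes leave
  open. Codes stay hidden and may contain \<open>Mu\<close>: this notion serves computability
  alone.\<close>

definition recfun :: "nat \<Rightarrow> (nat list \<Rightarrow> nat) \<Rightarrow> bool" where
  "recfun k F \<longleftrightarrow> (\<exists>p. \<forall>xs. length xs = k \<longrightarrow> rec_eval p xs (F xs))"

lemma rec_eval_Comp1:
  "rec_eval g xs y \<Longrightarrow> rec_eval f [y] z \<Longrightarrow> rec_eval (Comp f [g]) xs z"
  by (rule rec_eval.Comp[where ys = "[y]"]) auto

lemma recfun_proj: "i < k \<Longrightarrow> recfun k (\<lambda>xs. xs ! i)"
  unfolding recfun_def by (rule exI[of _ "Proj i"]) (auto intro: rec_eval.Proj)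

lemma recfun_comp:
  assumes "recfun (length Gs) F" and "\<forall>G\<in>set Gs. recfun k G"
  shows "recfun k (\<lambda>xs. F (map (\<lambda>G. G xs) Gs))"
proof -
  obtain p where p: "\<And>xs. length xs = length Gs \<Longrightarrow> rec_eval p xs (F xs)"
    using assms(1) by (auto simp: recfun_def)
  obtain q where q: "\<And>G xs. G \<in> set Gs \<Longrightarrow> length xs = k \<Longrightarrow> rec_eval (q G) xs (G xs)"
    using assms(2) unfolding recfun_def by metis
  show ?thesis unfolding recfun_def
  proof (intro exI[of _ "Comp p (map q Gs)"] allI impI)
    fix xs :: "nat list" assume "length xs = k"
    then show "rec_eval (Comp p (map q Gs)) xs (F (map (\<lambda>G. G xs) Gs))"
      by (intro rec_eval.Comp[where ys = "map (\<lambda>G. G xs) Gs"] p)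
        (auto simp: list_all2_conv_all_nth intro: q)
  qed
qed

lemma recfun_comp1:
  assumes "recfun 1 (\<lambda>xs. f (xs ! 0))" "recfun k F"
  shows "recfun k (\<lambda>xs. f (F xs))"
  using recfun_comp[of "[F]" "\<lambda>xs. f (xs ! 0)" k] assms by simp

lemma recfun_comp2:
  assumes "recfun 2 (\<lambda>xs. f (xs ! 0) (xs ! 1))" "recfun k F" "recfun k G"
  shows "recfun k (\<lambda>xs. f (F xs) (G xs))"
  using recfun_comp[of "[F, G]" "\<lambda>xs. f (xs ! 0) (xs ! 1)" k] assms
  by (simp add: numeral_2_eq_2)

lemma recfun_comp3:
  assumes "recfun 3 (\<lambda>xs. f (xs ! 0) (xs ! 1) (xs ! 2))" "recfun k F" "recfun k G" "recfun k H"
  shows "recfun k (\<lambda>xs. f (F xs) (G xs) (H xs))"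
  using recfun_comp[of "[F, G, H]" "\<lambda>xs. f (xs ! 0) (xs ! 1) (xs ! 2)" k] assms
  by (simp add: numeral_2_eq_2 numeral_3_eq_3)

text \<open>The function is given by its recursion equation, to be checked for parameter lists of
  length \<open>k\<close>, so applications never mention codes.\<close>

lemma recfun_primrec:
  assumes "recfun k (f 0)"
    and "recfun (Suc (Suc k)) G"
    and "\<And>n xs. length xs = k \<Longrightarrow> f (Suc n) xs = G (n # f n xs # xs)"
  shows "recfun (Suc k) (\<lambda>xs. f (hd xs) (tl xs))"
proof -
  obtain p where p: "\<And>xs. length xs = k \<Longrightarrow> rec_eval p xs (f 0 xs)"
    using assms(1) by (auto simp: recfun_def)
  obtain q where q: "\<And>xs. length xs = Suc (Suc k) \<Longrightarrow> rec_eval q xs (G xs)"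
    using assms(2) by (auto simp: recfun_def)
  have main: "rec_eval (PrimRec p q) (n # xs) (f n xs)" if "length xs = k" for n xs
  proof (induction n)
    case 0
    show ?case using p that by (auto intro: rec_eval.PrimRec_0)
  next
    case (Suc n)
    show ?case
      using Suc q[of "n # f n xs # xs"] that assms(3)[of xs n]
      by (auto intro: rec_eval.PrimRec_Suc)
  qed
  show ?thesis unfolding recfun_def
  proof (intro exI[of _ "PrimRec p q"] allI impI)
    fix xs :: "nat list" assume "length xs = Suc k"
    then show "rec_eval (PrimRec p q) xs (f (hd xs) (tl xs))"
      using main by (cases xs) auto
  qed
qed

lemma recfun_cong:
  "recfun k F \<Longrightarrow> (\<And>xs. length xs = k \<Longrightarrow> F xs = G xs) \<Longrightarrow> recfun k G"
  unfolding recfun_def by metis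

lemma recfun_primrec1:
  assumes "recfun 2 (\<lambda>xs. g (xs ! 0) (xs ! 1))" and "\<And>n. f (Suc n) = g n (f n)"
    and "recfun 0 (\<lambda>_. f 0)"
  shows "recfun 1 (\<lambda>xs. f (xs ! 0))"
proof -
  have "recfun (Suc 0) (\<lambda>xs. (\<lambda>n _. f n) (hd xs) (tl xs))"
    by (rule recfun_primrec[where G = "\<lambda>xs. g (xs ! 0) (xs ! 1)"])
      (use assms in \<open>auto simp: numeral_2_eq_2\<close>)
  then have "recfun 1 (\<lambda>xs. f (hd xs))" by simp
  then show ?thesis by (rule recfun_cong) (auto simp: length_Suc_conv)
qed

lemma recfun_primrec2:
  assumes "recfun 3 (\<lambda>xs. g (xs ! 0) (xs ! 1) (xs ! 2))"
    and "\<And>n x. f (Suc n) x = g n (f n x) x"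
    and "recfun 1 (\<lambda>xs. f 0 (xs ! 0))"
  shows "recfun 2 (\<lambda>xs. f (xs ! 0) (xs ! 1))"
proof -
  have "recfun (Suc 1) (\<lambda>xs. (\<lambda>n xs. f n (xs ! 0)) (hd xs) (tl xs))"
    by (rule recfun_primrec[where G = "\<lambda>xs. g (xs ! 0) (xs ! 1) (xs ! 2)"])
      (use assms in \<open>auto simp: numeral_2_eq_2 numeral_3_eq_3\<close>)
  then have "recfun 2 (\<lambda>xs. f (hd xs) (tl xs ! 0))" by (simp add: numeral_2_eq_2)
  then show ?thesis by (rule recfun_cong) (auto simp: length_Suc_conv numeral_2_eq_2)
qed

lemma recfun_Suc: "recfun k F \<Longrightarrow> recfun k (\<lambda>xs. Suc (F xs))"
proof (rule recfun_comp1[where f = Suc])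
  show "recfun 1 (\<lambda>xs. Suc (xs ! 0))" unfolding recfun_def
    by (rule exI[of _ Succ]) (auto simp: length_Suc_conv intro: rec_eval.Succ)
qed

lemma recfun_const: "recfun k (\<lambda>_. c)"
proof (induction c)
  case 0
  show ?case unfolding recfun_def by (rule exI[of _ Zero]) (auto intro: rec_eval.Zero)
next
  case (Suc c)
  then show ?case by (rule recfun_Suc)
qed

lemma recfun_add: "recfun k F \<Longrightarrow> recfun k G \<Longrightarrow> recfun k (\<lambda>xs. F xs + G xs)"
  by (rule recfun_comp2, rule recfun_primrec2[of "\<lambda>n y x. Suc y"])
    (auto intro!: recfun_Suc recfun_proj)

lemma recfun_pred: "recfun k F \<Longrightarrow> recfun k (\<lambda>xs. F xs - 1)"
  by (rule recfun_comp1, rule recfun_primrec1[of "\<lambda>n y. n"])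
    (auto intro!: recfun_const recfun_proj)

lemma recfun_diff:
  assumes "recfun k F" "recfun k G"
  shows "recfun k (\<lambda>xs. F xs - G xs)"
proof -
  \<comment> \<open>\<open>PrimRec\<close> recurses on the first argument, so subtraction is built
    with its arguments swapped: the subtrahend is the counter.\<close>
  have "recfun 2 (\<lambda>xs. (\<lambda>n m. m - n) (xs ! 0) (xs ! 1))"
  proof (rule recfun_primrec2)
    show "recfun 3 (\<lambda>xs. (\<lambda>n y x. y - 1) (xs ! 0) (xs ! 1) (xs ! 2))"
      by (intro recfun_pred recfun_proj) simp
  qed (auto intro!: recfun_proj)
  from recfun_comp2[OF this assms(2,1)] show ?thesis .
qed

lemma recfun_if:
  assumes "recfun k B" "recfun k F" "recfun k G"
  shows "recfun k (\<lambda>xs. if B xs = 0 then F xs else G xs)"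
proof -
  define c :: "nat \<Rightarrow> nat \<Rightarrow> nat \<Rightarrow> nat" where "c = (\<lambda>n a b. if n = 0 then a else b)"
  have "recfun 3 (\<lambda>xs. c (xs ! 0) (xs ! 1) (xs ! 2))"
  proof (rule recfun_cong)
    \<comment> \<open>A recursion ignoring its previous value is a case distinction: in the list
      \<open>[n, y, a, b]\<close>, position 3 holds the branch \<open>b\<close> for nonzero
      tests.\<close>
    have "recfun (Suc 2) (\<lambda>xs. (\<lambda>n xs. c n (xs ! 0) (xs ! 1)) (hd xs) (tl xs))"
      by (rule recfun_primrec[where G = "\<lambda>xs. xs ! 3"])
        (auto simp: c_def numeral_3_eq_3 intro!: recfun_proj)
    then show "recfun 3 (\<lambda>xs. c (hd xs) (tl xs ! 0) (tl xs ! 1))" by simp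
  qed (auto simp: length_Suc_conv numeral_2_eq_2 numeral_3_eq_3)
  from recfun_comp3[OF this assms] show ?thesis by (simp add: c_def)
qed

lemma recfun_mu:
  assumes "recfun (Suc k) (\<lambda>xs. F (hd xs) (tl xs))"
    and "\<And>xs. length xs = k \<Longrightarrow> \<exists>n. F n xs = 0"
  shows "recfun k (\<lambda>xs. LEAST n. F n xs = 0)"
proof -
  obtain p where "\<And>xs. length xs = Suc k \<Longrightarrow> rec_eval p xs (F (hd xs) (tl xs))"
    using assms(1) by (auto simp: recfun_def)
  then have p: "rec_eval p (n # xs) (F n xs)" if "length xs = k" for n xs
    using that by (metis length_Cons list.sel(1,3))
  show ?thesis unfolding recfun_def
  proof (intro exI[of _ "Mu p"] allI impI)
    fix xs :: "nat list" assume len: "length xs = k"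
    show "rec_eval (Mu p) xs (LEAST n. F n xs = 0)"
    proof (rule rec_eval.Mu)
      have "F (LEAST n. F n xs = 0) xs = 0" by (rule LeastI_ex) (rule assms(2)[OF len])
      then show "rec_eval p ((LEAST n. F n xs = 0) # xs) 0" using p[OF len] by metis
      show "\<forall>m<LEAST n. F n xs = 0. \<exists>k. rec_eval p (m # xs) (Suc k)"
        using p[OF len] not_less_Least by (metis not0_implies_Suc)
    qed
  qed
qed

section \<open>Pairing\<close>

definition pr :: "nat \<Rightarrow> nat \<Rightarrow> nat" where "pr a b = prod_encode (a, b)"
definition fst_of :: "nat \<Rightarrow> nat" where "fst_of n = fst (prod_decode n)"
definition snd_of :: "nat \<Rightarrow> nat" where "snd_of n = snd (prod_decode n)"

lemma fst_of_pr [simp]: "fst_of (pr a b) = a"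
  and snd_of_pr [simp]: "snd_of (pr a b) = b"
  and pr_fst_of_snd_of [simp]: "pr (fst_of n) (snd_of n) = n"
  by (simp_all add: pr_def fst_of_def snd_of_def)

lemma pr_eq_iff [simp]: "pr a b = pr c d \<longleftrightarrow> a = c \<and> b = d"
  by (simp add: pr_def)

lemma pr_0_0 [simp]: "pr 0 0 = 0"
  by (simp add: pr_def prod_encode_def)

lemma pr_eq_0_iff [simp]: "pr a b = 0 \<longleftrightarrow> a = 0 \<and> b = 0"
  using pr_eq_iff[of a b 0 0] by simp

lemma pr_pos_iff [simp]: "0 < pr a b \<longleftrightarrow> 0 < a \<or> 0 < b"
  using pr_eq_0_iff[of a b] by linarith

lemma fst_of_0 [simp]: "fst_of 0 = 0" and snd_of_0 [simp]: "snd_of 0 = 0"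
  using fst_of_pr[of 0 0] snd_of_pr[of 0 0] by simp_all

lemma fst_of_le: "fst_of n \<le> n" and snd_of_le: "snd_of n \<le> n"
  using le_prod_encode_1[of "fst_of n" "snd_of n"] le_prod_encode_2[of "snd_of n" "fst_of n"]
  by (simp_all flip: pr_def)

lemma triangle_ge: "n \<le> triangle n"
  by (induction n) auto

text \<open>Termination of programs rests on this: subprograms sit in \<open>snd_of c\<close>, and a
  nonzero tag makes them numerically smaller. Tag 0 is an exception (\<open>snd_of 1 = 1\<close>);
  it is given to the successor, which has no subprograms.\<close>

lemma snd_of_less: "fst_of n \<noteq> 0 \<Longrightarrow> snd_of n < n"
proof -
  assume "fst_of n \<noteq> 0"
  moreover have "n = triangle (fst_of n + snd_of n) + fst_of n"
    using pr_fst_of_snd_of[of n] by (simp add: pr_def prod_encode_def)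
  ultimately show ?thesis using triangle_ge[of "fst_of n + snd_of n"] by linarith
qed

lemma recfun_triangle: "recfun k F \<Longrightarrow> recfun k (\<lambda>xs. triangle (F xs))"
  by (rule recfun_comp1, rule recfun_primrec1[of "\<lambda>n y. y + Suc n"])
    (auto intro!: recfun_const recfun_Suc recfun_add recfun_proj)

lemma recfun_pr:
  assumes "recfun k F" "recfun k G"
  shows "recfun k (\<lambda>xs. pr (F xs) (G xs))"
  unfolding pr_def prod_encode_def prod.case
  by (intro recfun_add recfun_triangle assms)

text \<open>The sum \<open>a + b\<close> of the components of \<open>n = pr a b\<close> is the index of the last triangular number
  that does not exceed \<open>n\<close>.\<close>

lemma sum_of_Suc:
  "fst_of (Suc n) + snd_of (Suc n) =
    (if triangle (Suc (fst_of n + snd_of n)) - Suc n = 0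
     then Suc (fst_of n + snd_of n) else fst_of n + snd_of n)"
proof (cases "snd_of n")
  case 0
  \<comment> \<open>Here \<open>n\<close> is the last code on its diagonal, and \<open>Suc n\<close>
    opens the next one.\<close>
  have "Suc n = pr 0 (Suc (fst_of n))"
    using pr_fst_of_snd_of[of n] 0 by (simp add: pr_def prod_encode_def)
  moreover have "n = triangle (fst_of n) + fst_of n"
    using pr_fst_of_snd_of[of n] 0 by (simp add: pr_def prod_encode_def)
  ultimately show ?thesis using 0 by simp
next
  case (Suc b)
  have "n = triangle (Suc (fst_of n + b)) + fst_of n"
    using pr_fst_of_snd_of[of n] Suc by (simp add: pr_def prod_encode_def)
  moreover from this have "Suc n = pr (Suc (fst_of n)) b"
    by (simp add: pr_def prod_encode_def)
  ultimately show ?thesis using Suc by simp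
qed

text \<open>The index of the diagonal is what recursion on \<open>n\<close> yields; both components
  are recovered from it by subtraction.\<close>

lemma recfun_sum_of: "recfun k F \<Longrightarrow> recfun k (\<lambda>xs. fst_of (F xs) + snd_of (F xs))"
  by (rule recfun_comp1[where f = "\<lambda>n. fst_of n + snd_of n"],
      rule recfun_primrec1[of "\<lambda>n y. if triangle (Suc y) - Suc n = 0 then Suc y else y"])
    (auto simp only: sum_of_Suc intro!: recfun_const recfun_Suc recfun_if recfun_diff
      recfun_triangle recfun_proj)

lemma recfun_fst_of:
  assumes "recfun k F"
  shows "recfun k (\<lambda>xs. fst_of (F xs))"
proof -
  have "fst_of n = n - triangle (fst_of n + snd_of n)" for n
    using pr_fst_of_snd_of[of n] by (simp add: pr_def prod_encode_def)
  then have eq: "(\<lambda>xs. fst_of (F xs)) = (\<lambda>xs. F xs - triangle (fst_of (F xs) + snd_of (F xs)))"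
    by blast
  show ?thesis unfolding eq by (intro recfun_diff recfun_triangle recfun_sum_of assms)
qed

lemma recfun_snd_of:
  assumes "recfun k F"
  shows "recfun k (\<lambda>xs. snd_of (F xs))"
proof -
  have eq: "(\<lambda>xs. snd_of (F xs)) = (\<lambda>xs. fst_of (F xs) + snd_of (F xs) - fst_of (F xs))"
    by simp
  show ?thesis unfolding eq by (intro recfun_diff recfun_sum_of recfun_fst_of assms)
qed

lemmas recfun_intros =
  recfun_Suc recfun_const recfun_add recfun_pred recfun_diff recfun_if recfun_pr
  recfun_fst_of recfun_snd_of

section \<open>A stack machine for a language of total functions\<close>

text \<open>
  Stacks of programs are coded by \<open>0\<close> (empty) and \<open>push c r\<close>; a machine state is a pair of a stack
  and a value. A program is a pair of a tag and an argument. The tags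
  \<open>0, 1, 2, 3, 4, 5\<close> stand for successor, first component, second component, \<open>v \<mapsto> pr arg v\<close>,
  composition and pairing of functions; tag \<open>6\<close> is the continuation used for the second half of a
  pairing; all other tags stand for iteration, \<open>pr n x \<mapsto> f\<^sup>n x\<close>.
\<close>

definition push :: "nat \<Rightarrow> nat \<Rightarrow> nat" where "push c r = Suc (pr c r)"

text \<open>With smaller tags ruled out, \<open>t - i = 0\<close> means \<open>t = i\<close>; this
  is the form of test accepted by \<open>recfun_if\<close>. A round of iteration schedules the body,
  then an attachment of the decreased counter, then \<open>c\<close> itself.\<close>

definition exec :: "nat \<Rightarrow> nat \<Rightarrow> nat \<Rightarrow> nat" where
  "exec c r v = (let t = fst_of c; a = snd_of c in
     if t = 0 then pr r (Suc v)
     else if t - 1 = 0 then pr r (fst_of v)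
     else if t - 2 = 0 then pr r (snd_of v)
     else if t - 3 = 0 then pr r (pr a v)
     else if t - 4 = 0 then pr (push (snd_of a) (push (fst_of a) r)) v
     else if t - 5 = 0 then pr (push (fst_of a) (push (pr 6 (pr (snd_of a) v)) r)) v
     else if t - 6 = 0 then pr (push (fst_of a) (push (pr 3 v) r)) (snd_of a)
     else if fst_of v = 0 then pr r (snd_of v)
     else pr (push a (push (pr 3 (fst_of v - 1)) (push c r))) (snd_of v))"

text \<open>States with empty stack are fixed points, so the result can be read off at any time
  after halting.\<close>

definition step :: "nat \<Rightarrow> nat" where
  "step z = (if fst_of z = 0 then z
     else exec (fst_of (fst_of z - 1)) (snd_of (fst_of z - 1)) (snd_of z))"

lemma step_push: "step (pr (push c r) v) = exec c r v"
  by (simp add: step_def push_def)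

lemma recfun_step: "recfun k F \<Longrightarrow> recfun k (\<lambda>xs. step (F xs))"
  unfolding step_def exec_def push_def Let_def by (intro recfun_intros)

lemma recfun_steps:
  assumes "recfun k F" "recfun k G"
  shows "recfun k (\<lambda>xs. (step ^^ F xs) (G xs))"
  by (rule recfun_comp2[OF _ assms], rule recfun_primrec2[of "\<lambda>n y x. step y"])
    (auto intro!: recfun_step recfun_proj)

section \<open>Big-step behaviour of programs\<close>

definition reaches :: "nat \<Rightarrow> nat \<Rightarrow> bool" where
  "reaches s s' \<longleftrightarrow> (\<exists>t. (step ^^ t) s = s')"

lemma reaches_refl: "reaches s s"
  unfolding reaches_def by (rule exI[of _ 0]) simp

lemma reaches_step: "reaches (step s) s' \<Longrightarrow> reaches s s'"
  unfolding reaches_def by (metis funpow_Suc_right comp_apply)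

lemma reaches_trans: "reaches s s' \<Longrightarrow> reaches s' s'' \<Longrightarrow> reaches s s''"
  unfolding reaches_def by (metis funpow_add comp_apply)

text \<open>The quantifier over the rest \<open>r\<close> of the stack makes runs composable: a
  subprogram behaves alike whatever waits below it.\<close>

definition runs :: "nat \<Rightarrow> nat \<Rightarrow> nat \<Rightarrow> bool" where
  "runs c v w \<longleftrightarrow> (\<forall>r. reaches (pr (push c r) v) (pr r w))"

lemma runs_trans: "runs c v w \<Longrightarrow> reaches (pr r w) s \<Longrightarrow> reaches (pr (push c r) v) s"
  unfolding runs_def by (blast intro: reaches_trans)

lemma runsI: "(\<And>r. reaches (exec c r v) (pr r w)) \<Longrightarrow> runs c v w"
  unfolding runs_def by (metis reaches_step step_push)

lemma runs_Suc: "runs (pr 0 a) v (Suc v)"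
  by (rule runsI) (simp add: exec_def reaches_refl)

lemma runs_fst: "runs (pr 1 a) v (fst_of v)"
  by (rule runsI) (simp add: exec_def reaches_refl)

lemma runs_snd: "runs (pr 2 a) v (snd_of v)"
  by (rule runsI) (simp add: exec_def reaches_refl)

lemma runs_attach: "runs (pr 3 a) v (pr a v)"
  by (rule runsI) (simp add: exec_def reaches_refl)

lemma runs_comp: "runs b v w \<Longrightarrow> runs a w z \<Longrightarrow> runs (pr 4 (pr a b)) v z"
  by (rule runsI) (auto simp: exec_def intro!: runs_trans reaches_refl)

text \<open>The machine holds only one value, so the continuation carries the original input
  \<open>v\<close> in its own code, and the first result \<open>w\<close> is saved in an attachment
  program while \<open>b\<close> runs.\<close>

lemma runs_second: "runs b v z \<Longrightarrow> runs (pr 6 (pr b v)) w (pr w z)"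
  by (rule runsI) (auto simp: exec_def intro!: runs_trans[of b] runs_trans[OF runs_attach] reaches_refl)

lemma runs_pair: "runs a v w \<Longrightarrow> runs b v z \<Longrightarrow> runs (pr 5 (pr a b)) v (pr w z)"
  by (rule runsI)
    (auto simp: exec_def intro!: runs_trans[of a] runs_trans[OF runs_second] reaches_refl)

lemma runs_iter_0: "fst_of c > 6 \<Longrightarrow> runs c (pr 0 x) x"
  by (rule runsI) (simp add: exec_def reaches_refl)

lemma runs_iter_Suc:
  "fst_of c > 6 \<Longrightarrow> runs (snd_of c) x y \<Longrightarrow> runs c (pr n y) z \<Longrightarrow> runs c (pr (Suc n) x) z"
  by (rule runsI)
    (auto simp: exec_def intro!: runs_trans[of "snd_of c"] runs_trans[OF runs_attach]
      runs_trans[of c] reaches_refl)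

lemma runs_total: "\<exists>w. runs c v w"
proof (induction c arbitrary: v rule: less_induct)
  case (less c)
  obtain t a b where c: "c = pr t (pr a b)" by (metis pr_fst_of_snd_of)
  have sub: "\<exists>w. runs (pr a b) v w" "\<exists>w. runs a v w" "\<exists>w. runs b v w" if "t \<noteq> 0" for v
  proof -
    have "pr a b < c" using snd_of_less[of c] that by (simp add: c)
    moreover have "a \<le> pr a b" "b \<le> pr a b"
      using fst_of_le[of "pr a b"] snd_of_le[of "pr a b"] by simp_all
    ultimately show "\<exists>w. runs (pr a b) v w" "\<exists>w. runs a v w" "\<exists>w. runs b v w"
      by (auto intro: less.IH)
  qed
  consider "t = 0" | "t = 1" | "t = 2" | "t = 3" | "t = 4" | "t = 5" | "t = 6" | "t > 6"
    by linarith
  then show ?case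
  proof cases
    case 1 then show ?thesis unfolding c by (blast intro: runs_Suc)
  next
    case 2 then show ?thesis unfolding c by (blast intro: runs_fst)
  next
    case 3 then show ?thesis unfolding c by (blast intro: runs_snd)
  next
    case 4 then show ?thesis unfolding c by (blast intro: runs_attach)
  next
    case 5
    then obtain w where w: "runs b v w" using sub(3) by auto
    obtain z where "runs a w z" using sub(2) 5 by auto
    with w show ?thesis unfolding c 5 by (blast intro: runs_comp)
  next
    case 6
    then obtain w where w: "runs a v w" using sub(2) by auto
    obtain z where "runs b v z" using sub(3) 6 by auto
    with w show ?thesis unfolding c 6 by (blast intro: runs_pair)
  next
    case 7
    then obtain z where "runs a b z" using sub(2) by auto
    then show ?thesis unfolding c 7 by (blast intro: runs_second)
  next
    \<comment> \<open>Iteration schedules the same code \<open>c\<close> again, so the induction on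
      codes does not suffice; an inner induction on the counter handles these calls.\<close>
    case 8
    have "\<exists>w. runs c (pr n x) w" for n x
    proof (induction n arbitrary: x)
      case 0
      show ?case using runs_iter_0[of c x] 8 c by auto
    next
      case (Suc n)
      obtain y where y: "runs (snd_of c) x y" using sub(1)[of x] 8 c by auto
      obtain z where "runs c (pr n y) z" using Suc by blast
      with y show ?case using runs_iter_Suc[of c x y n z] 8 c by auto
    qed
    from this[of "fst_of v" "snd_of v"] show ?thesis by simp
  qed
qed

text \<open>The universal function of the language. The search for the halting time is the single
  use of minimisation in showing the diagonal set computable.\<close>

definition run_result :: "nat \<Rightarrow> nat \<Rightarrow> nat" where
  "run_result c v =
    snd_of ((step ^^ (LEAST t. fst_of ((step ^^ t) (pr (push c 0) v)) = 0)) (pr (push c 0) v))"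

lemma run_result_eq: "runs c v w \<Longrightarrow> run_result c v = w"
proof -
  assume "runs c v w"
  then obtain t where t: "(step ^^ t) (pr (push c 0) v) = pr 0 w"
    by (auto simp: runs_def reaches_def)
  define s where "s = (\<lambda>t. (step ^^ t) (pr (push c 0) v))"
  define l where "l = (LEAST t. fst_of (s t) = 0)"
  have "fst_of (s t) = 0" using t by (simp add: s_def)
  then have l: "fst_of (s l) = 0" "l \<le> t"
    unfolding l_def by (rule LeastI, rule Least_le)
  \<comment> \<open>Halted states do not change, so the state at the first halting time
    \<open>l\<close> is the one known at time \<open>t\<close>.\<close>
  have "s (l + d) = s l" for d
    by (induction d) (use l(1) in \<open>auto simp: s_def step_def\<close>)
  from this[of "t - l"] have "s l = pr 0 w" using l(2) t by (simp add: s_def)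
  moreover have "run_result c v = snd_of (s l)" by (simp add: run_result_def s_def l_def)
  ultimately show ?thesis by simp
qed

lemma recfun_run_result:
  assumes "recfun k F" "recfun k G"
  shows "recfun k (\<lambda>xs. run_result (F xs) (G xs))"
proof (rule recfun_comp2[OF _ assms])
  let ?s = "\<lambda>xs. pr (push (xs ! 0) 0) (xs ! 1)"
  have init: "recfun 2 ?s"
    unfolding push_def by (intro recfun_intros recfun_proj) auto
  have "recfun (Suc 2) (\<lambda>xs. fst_of ((step ^^ hd xs) (?s (tl xs))))"
  proof (rule recfun_cong)
    show "recfun (Suc 2) (\<lambda>xs. fst_of ((step ^^ (xs ! 0)) (pr (push (xs ! 1) 0) (xs ! 2))))"
      unfolding push_def by (intro recfun_intros recfun_proj recfun_steps) auto
  qed (auto simp: length_Suc_conv numeral_2_eq_2)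
  moreover have "\<exists>t. fst_of ((step ^^ t) (?s xs)) = 0" for xs
  proof -
    obtain w where "runs (xs ! 0) (xs ! 1) w" using runs_total by blast
    then obtain t where "(step ^^ t) (?s xs) = pr 0 w" by (auto simp: runs_def reaches_def)
    then show ?thesis by (metis fst_of_pr)
  qed
  ultimately have "recfun 2 (\<lambda>xs. LEAST t. fst_of ((step ^^ t) (?s xs)) = 0)"
    by (rule recfun_mu)
  then show "recfun 2 (\<lambda>xs. run_result (xs ! 0) (xs ! 1))"
    unfolding run_result_def by (intro recfun_snd_of recfun_steps init)
qed

section \<open>The language contains all primitive recursive functions\<close>

definition programmable :: "(nat \<Rightarrow> nat) \<Rightarrow> bool" where
  "programmable f \<longleftrightarrow> (\<exists>c. \<forall>v. runs c v (f v))"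

lemma programmable_comp:
  "programmable f \<Longrightarrow> programmable g \<Longrightarrow> programmable (\<lambda>v. f (g v))"
  unfolding programmable_def by (metis runs_comp)

lemma programmable_fst: "programmable f \<Longrightarrow> programmable (\<lambda>v. fst_of (f v))"
  by (rule programmable_comp[of fst_of]) (use runs_fst in \<open>auto simp: programmable_def\<close>)

lemma programmable_snd: "programmable f \<Longrightarrow> programmable (\<lambda>v. snd_of (f v))"
  by (rule programmable_comp[of snd_of]) (use runs_snd in \<open>auto simp: programmable_def\<close>)

lemma programmable_Suc: "programmable f \<Longrightarrow> programmable (\<lambda>v. Suc (f v))"
  by (rule programmable_comp[of Suc]) (use runs_Suc in \<open>auto simp: programmable_def\<close>)

lemma programmable_pr:
  "programmable f \<Longrightarrow> programmable g \<Longrightarrow> programmable (\<lambda>v. pr (f v) (g v))"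
  unfolding programmable_def by (metis runs_pair)

text \<open>Projecting \<open>pr a v\<close> to its components yields the identity and the
  constants, which have no tags of their own.\<close>

lemma programmable_attach: "programmable (pr a)"
  unfolding programmable_def using runs_attach by blast

lemma programmable_id: "programmable (\<lambda>v. v)"
  using programmable_snd[OF programmable_attach] by simp

lemma programmable_const: "programmable (\<lambda>_. a)"
  using programmable_fst[OF programmable_attach] by simp

lemma programmable_iter:
  assumes "programmable f" "programmable g" "programmable h"
  shows "programmable (\<lambda>v. (f ^^ g v) (h v))"
proof -
  obtain c where c: "\<And>v. runs c v (f v)" using assms(1) by (auto simp: programmable_def)
  \<comment> \<open>Any tag above 6 means iteration; 7 is the least.\<close>
  have "runs (pr 7 c) (pr n x) ((f ^^ n) x)" for n x
  proof (induction n arbitrary: x)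
    case 0
    show ?case using runs_iter_0[of "pr 7 c" x] by simp
  next
    case (Suc n)
    show ?case using runs_iter_Suc[of "pr 7 c" x "f x", OF _ _ Suc] c
      by (simp add: funpow_swap1)
  qed
  then have "programmable (\<lambda>v. (f ^^ fst_of v) (snd_of v))"
    unfolding programmable_def by (metis pr_fst_of_snd_of)
  from programmable_comp[OF this programmable_pr[OF assms(2,3)]] show ?thesis by simp
qed

fun tuple :: "nat list \<Rightarrow> nat" where
  "tuple [] = 0"
| "tuple (x # xs) = pr x (tuple xs)"

lemma tuple_nth: "i < length xs \<Longrightarrow> fst_of ((snd_of ^^ i) (tuple xs)) = xs ! i"
proof (induction xs arbitrary: i)
  case (Cons x xs)
  then show ?case by (cases i) (auto simp: funpow_swap1)
qed simp

text \<open>The coding by \<open>tuple\<close> does not determine the length of the list. This is harmless: the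
  programmed function only has to agree with \<open>p\<close> where the arity fits.\<close>

lemma programmable_if_mu_free:
  "mu_free p \<Longrightarrow> \<exists>f. programmable f \<and> (\<forall>xs z. rec_eval p xs z \<longrightarrow> f (tuple xs) = z)"
proof (induction p)
  case Zero
  then show ?case
    by (intro exI[of _ "\<lambda>_. 0"]) (auto intro: programmable_const elim: rec_eval_ZeroE)
next
  case Succ
  then show ?case
    by (intro exI[of _ "\<lambda>v. Suc (fst_of v)"])
      (auto intro!: programmable_Suc programmable_fst programmable_id elim!: rec_eval_SuccE)
next
  case (Proj i)
  then show ?case
    by (intro exI[of _ "\<lambda>v. fst_of ((snd_of ^^ i) v)"])
      (auto intro!: programmable_fst programmable_snd programmable_iter programmable_id
        programmable_const elim!: rec_eval_ProjE simp: tuple_nth)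
next
  case (Comp p gs)
  obtain f where f: "programmable f" "\<And>xs z. rec_eval p xs z \<Longrightarrow> f (tuple xs) = z"
    using Comp by auto
  have "\<forall>g\<in>set gs. \<exists>f. programmable f \<and> (\<forall>xs z. rec_eval g xs z \<longrightarrow> f (tuple xs) = z)"
    using Comp by auto
  \<comment> \<open>The inner functions are gathered into one program that outputs the coded list of
    all their values.\<close>
  then have "\<exists>h. programmable h \<and>
    (\<forall>xs ys. list_all2 (\<lambda>g y. rec_eval g xs y) gs ys \<longrightarrow> h (tuple xs) = tuple ys)"
  proof (induction gs)
    case Nil
    show ?case by (intro exI[of _ "\<lambda>_. 0"]) (auto intro: programmable_const)
  next
    case (Cons g gs)
    then obtain h f where "programmable h" "programmable f"
      "\<And>xs ys. list_all2 (\<lambda>g y. rec_eval g xs y) gs ys \<Longrightarrow> h (tuple xs) = tuple ys"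
      "\<And>xs z. rec_eval g xs z \<Longrightarrow> f (tuple xs) = z"
      by auto
    then show ?case
      by (intro exI[of _ "\<lambda>v. pr (f v) (h v)"]) (auto intro: programmable_pr simp: list_all2_Cons1)
  qed
  then obtain h where h: "programmable h"
    "\<And>xs ys. list_all2 (\<lambda>g y. rec_eval g xs y) gs ys \<Longrightarrow> h (tuple xs) = tuple ys"
    by auto
  show ?case
    by (intro exI[of _ "\<lambda>v. f (h v)"])
      (auto intro: programmable_comp f h elim!: rec_eval_CompE simp: f(2) h(2))
next
  case (PrimRec p q)
  obtain f where f: "programmable f" "\<And>xs z. rec_eval p xs z \<Longrightarrow> f (tuple xs) = z"
    using PrimRec by auto
  obtain g where g: "programmable g" "\<And>xs z. rec_eval q xs z \<Longrightarrow> g (tuple xs) = z"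
    using PrimRec by auto
  \<comment> \<open>The iterated state is \<open>tuple (n # z # xs)\<close>: counter, current value,
    parameters. This is the argument list of \<open>q\<close>, so \<open>g\<close> applies to it
    directly.\<close>
  define h where "h = (\<lambda>v. pr (Suc (fst_of v)) (pr (g v) (snd_of (snd_of v))))"
  define it where "it = (\<lambda>v. (h ^^ fst_of v) (pr 0 (pr (f (snd_of v)) (snd_of v))))"
  have "programmable h" unfolding h_def
    by (intro programmable_pr programmable_Suc programmable_fst programmable_snd programmable_id g)
  then have prog: "programmable (\<lambda>v. fst_of (snd_of (it v)))" unfolding it_def
    by (intro programmable_fst programmable_snd programmable_iter programmable_pr
        programmable_const programmable_id programmable_comp[OF f(1)])
  have it: "it (tuple (n # xs)) = tuple (n # z # xs)" if "rec_eval (PrimRec p q) (n # xs) z" for n xs z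
    using that
  proof (induction n arbitrary: z)
    case 0
    then show ?case by (auto simp: it_def f(2) elim: rec_eval_PrimRec_0E)
  next
    case (Suc n)
    from Suc.prems obtain y where y: "rec_eval (PrimRec p q) (n # xs) y"
      "rec_eval q (n # y # xs) z"
      by (auto elim: rec_eval_PrimRec_SucE)
    have "it (tuple (Suc n # xs)) = h (it (tuple (n # xs)))" by (simp add: it_def)
    also have "\<dots> = h (tuple (n # y # xs))" using Suc.IH[OF y(1)] by simp
    also have "\<dots> = tuple (Suc n # z # xs)" using g(2)[OF y(2)] by (simp add: h_def)
    finally show ?case .
  qed
  \<comment> \<open>\<open>PrimRec\<close> has values on nonempty lists only, so the fact
    \<open>it\<close> covers every evaluation.\<close>
  have "\<exists>n ys. xs = n # ys" if "rec_eval (PrimRec p q) xs z" for xs z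
    using that by (cases rule: rec_eval.cases) auto
  then show ?case
    using it prog by (intro exI[of _ "\<lambda>v. fst_of (snd_of (it v))"]) fastforce
next
  case (Mu p)
  then show ?case by simp
qed

section \<open>A computable set that is not primitive recursive\<close>

text \<open>The input is \<open>tuple [n]\<close> and not \<open>n\<close>, since programs
  translated from codes expect a coded argument list.\<close>

definition diag :: "nat set" where
  "diag = {n. run_result n (tuple [n]) = 0}"

lemma recfun_diag: "recfun k F \<Longrightarrow> recfun k (\<lambda>xs. if F xs \<in> diag then 1 else 0)"
  unfolding diag_def mem_Collect_eq tuple.simps by (intro recfun_intros recfun_run_result)

lemma diag_not_primitive_recursive: "\<not> primitive_recursive (\<lambda>n. if n \<in> diag then 1 else 0)"
proof
  assume "primitive_recursive (\<lambda>n. if n \<in> diag then 1 else 0)"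
  then obtain p where p: "mu_free p" "\<And>n. rec_eval p [n] (if n \<in> diag then 1 else 0)"
    by (auto simp: primitive_recursive_def)
  obtain f where f: "programmable f" "\<And>xs z. rec_eval p xs z \<Longrightarrow> f (tuple xs) = z"
    using programmable_if_mu_free[OF p(1)] by blast
  obtain c where "\<And>v. runs c v (f v)" using f(1) by (auto simp: programmable_def)
  then have "run_result c (tuple [c]) = f (tuple [c])" by (rule run_result_eq)
  \<comment> \<open>The result is 0 exactly when \<open>c\<close> is outside \<open>diag\<close>,
    while by definition of \<open>diag\<close> it is 0 exactly when \<open>c\<close> is
    inside.\<close>
  also have "\<dots> = (if c \<in> diag then 1 else 0)" using f(2) p(2) by blast
  finally show False by (auto simp: diag_def split: if_splits)
qed

section \<open>The tree\<close>

text \<open>The empty node is \<open>0 = pr 0 0\<close>, the spine consists of the nodes \<open>pr 1 n\<close>, and \<open>pr 2 n\<close> is the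
  leaf attached to the \<open>n\<close>-th spine node.\<close>

definition comb :: "nat set \<Rightarrow> nat succ_structure" where
  "comb A = \<lparr>nodes = {0} \<union> range (pr 1) \<union> pr 2 ` A,
     succ1 = (\<lambda>x. if fst_of x = 1 then pr 1 (Suc (snd_of x)) else 0),
     succ2 = (\<lambda>x. if fst_of x = 1 \<and> snd_of x \<in> A then pr 2 (snd_of x) else 0),
     empty_node = 0, root = pr 1 0\<rparr>"

lemma wf_comb: "wf_structure (comb A)"
  by (auto simp: wf_structure_def comb_def)

lemma infinite_comb: "infinite (nodes (comb A))"
proof -
  have "infinite (range (pr 1))" by (intro notI, drule finite_imageD) (auto simp: inj_def)
  then show ?thesis by (simp add: comb_def)
qed

text \<open>The sum of components is a rank: \<open>n + 1\<close> on the spine node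
  \<open>pr 1 n\<close>, \<open>n + 2\<close> on its leaf and on the next spine node. Every edge
  raises it or leads to the empty node, which is never left again. Cycles mixing both successors are
  thus excluded too.\<close>

lemma comb_trancl:
  assumes "(x, y) \<in> (child_rel (comb A))\<^sup>+"
  shows "y = 0 \<or> (x \<noteq> 0 \<and> fst_of x + snd_of x < fst_of y + snd_of y)"
  using assms
  by (induction rule: trancl_induct) (auto simp: child_rel_def comb_def split: if_splits)

lemma binary_successor_tree_comb: "binary_successor_tree (comb A)"
proof -
  let ?C = "comb A"
  have e: "empty_node ?C = 0" by (simp add: comb_def)
  have "(x, x) \<notin> (child_rel ?C)\<^sup>+" if "x \<in> nodes ?C - {empty_node ?C}" for x
    using comb_trancl[of x x A] that by (auto simp: comb_def)
  moreover have "inj_on (succ1 ?C) (nodes ?C - {x \<in> nodes ?C. succ1 ?C x = empty_node ?C})"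
  proof (rule inj_onI)
    fix x y
    assume "x \<in> nodes ?C - {x \<in> nodes ?C. succ1 ?C x = empty_node ?C}"
      "y \<in> nodes ?C - {x \<in> nodes ?C. succ1 ?C x = empty_node ?C}" "succ1 ?C x = succ1 ?C y"
    then have "succ1 ?C x \<noteq> 0" "succ1 ?C y \<noteq> 0" "succ1 ?C x = succ1 ?C y"
      by (auto simp: e)
    then have "fst_of x = fst_of y" "snd_of x = snd_of y"
      by (simp_all add: comb_def split: if_splits)
    then show "x = y" by (metis pr_fst_of_snd_of)
  qed
  moreover have "inj_on (succ2 ?C) (nodes ?C - {x \<in> nodes ?C. succ2 ?C x = empty_node ?C})"
  proof (rule inj_onI)
    fix x y
    assume "x \<in> nodes ?C - {x \<in> nodes ?C. succ2 ?C x = empty_node ?C}"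
      "y \<in> nodes ?C - {x \<in> nodes ?C. succ2 ?C x = empty_node ?C}" "succ2 ?C x = succ2 ?C y"
    then have "succ2 ?C x \<noteq> 0" "succ2 ?C y \<noteq> 0" "succ2 ?C x = succ2 ?C y"
      by (auto simp: e)
    then have "fst_of x = fst_of y" "snd_of x = snd_of y"
      by (simp_all add: comb_def split: if_splits)
    then show "x = y" by (metis pr_fst_of_snd_of)
  qed
  moreover have "succ1 ?C ` nodes ?C \<inter> succ2 ?C ` nodes ?C = {empty_node ?C}"
  proof (intro equalityI subsetI)
    fix z assume "z \<in> succ1 ?C ` nodes ?C \<inter> succ2 ?C ` nodes ?C"
    then obtain x y where "z = succ1 ?C x" "z = succ2 ?C y" by blast
    then show "z \<in> {empty_node ?C}" by (simp add: comb_def split: if_splits)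
  next
    fix z assume z: "z \<in> {empty_node ?C}"
    have "succ1 ?C 0 = 0" "succ2 ?C 0 = 0" "0 \<in> nodes ?C" by (simp_all add: comb_def)
    then have "0 \<in> succ1 ?C ` nodes ?C" "0 \<in> succ2 ?C ` nodes ?C" by (metis imageI)+
    with z show "z \<in> succ1 ?C ` nodes ?C \<inter> succ2 ?C ` nodes ?C" by (simp add: comb_def)
  qed
  moreover have "succ1 ?C ` nodes ?C \<union> succ2 ?C ` nodes ?C = nodes ?C - {root ?C}"
  proof (intro equalityI subsetI)
    fix x assume "x \<in> nodes ?C - {root ?C}"
    then consider "x = 0" | n where "x = pr 1 (Suc n)" | n where "x = pr 2 n" "n \<in> A"
      by (auto simp: comb_def gr0_conv_Suc)
    then show "x \<in> succ1 ?C ` nodes ?C \<union> succ2 ?C ` nodes ?C"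
    proof cases
      case 1
      have "succ1 ?C 0 = 0" "0 \<in> nodes ?C" by (auto simp: comb_def)
      with 1 show ?thesis by (metis UnI1 imageI)
    next
      case (2 n)
      have "succ1 ?C (pr 1 n) = x" "pr 1 n \<in> nodes ?C" using 2 by (auto simp: comb_def)
      then show ?thesis by (metis UnI1 imageI)
    next
      case (3 n)
      have "succ2 ?C (pr 1 n) = x" "pr 1 n \<in> nodes ?C" using 3 by (auto simp: comb_def)
      then show ?thesis by (metis UnI2 imageI)
    qed
  qed (auto simp: comb_def split: if_splits)
  moreover have "succ1 ?C (empty_node ?C) = empty_node ?C" "succ2 ?C (empty_node ?C) = empty_node ?C"
    by (auto simp: comb_def)
  ultimately show ?thesis unfolding binary_successor_tree_def using wf_comb by blast
qed

section \<open>Computability of the comb\<close>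

lemma computable_on_if_recfun: "recfun 1 (\<lambda>xs. f (xs ! 0)) \<Longrightarrow> computable_on D f"
proof -
  assume "recfun 1 (\<lambda>xs. f (xs ! 0))"
  then obtain p where p: "\<And>xs. length xs = 1 \<Longrightarrow> rec_eval p xs (f (xs ! 0))"
    by (auto simp: recfun_def)
  have "rec_eval p [x] (f x)" for x using p[of "[x]"] by simp
  then show ?thesis by (auto simp: computable_on_def)
qed

lemma computable_structure_comb:
  assumes "recfun 1 (\<lambda>xs. if xs ! 0 \<in> A then 1 else 0)"
  shows "computable_structure (comb A)"
proof -
  define a :: "nat \<Rightarrow> nat" where "a = (\<lambda>n. if n \<in> A then 1 else 0)"
  have a: "recfun k (\<lambda>xs. a (F xs))" if "recfun k F" for k F
    using recfun_comp1[OF _ that, of a] assms by (simp add: a_def)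
  have node: "x \<in> nodes (comb A) \<longleftrightarrow>
    x = 0 \<or> fst_of x = 1 \<or> (fst_of x = 2 \<and> snd_of x \<in> A)" for x
    by (auto simp: comb_def image_iff) (metis pr_fst_of_snd_of)+
  \<comment> \<open>Membership is rewritten as nested tests for 0, the shape that
    \<open>recfun_if\<close> handles.\<close>
  have "(if x \<in> nodes (comb A) then 1 else 0) =
    (if x = 0 then 1 else if fst_of x = 0 then 0 else if fst_of x - 1 = 0 then 1
     else if fst_of x - 2 = 0 then a (snd_of x) else 0)" for x
    by (auto simp: node a_def)
  then have "computable_set (nodes (comb A))"
    unfolding computable_set_def
    by (simp only:) (intro computable_on_if_recfun recfun_intros a recfun_proj; simp)
  moreover have "succ1 (comb A) = (\<lambda>x. if fst_of x = 0 then 0 else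
    if fst_of x - 1 = 0 then pr 1 (Suc (snd_of x)) else 0)"
    by (auto simp: comb_def fun_eq_iff)
  then have "computable_on (nodes (comb A)) (succ1 (comb A))"
    by (simp only:) (intro computable_on_if_recfun recfun_intros recfun_proj; simp)
  moreover have "succ2 (comb A) = (\<lambda>x. if fst_of x = 0 then 0 else
    if fst_of x - 1 = 0 then if a (snd_of x) = 0 then 0 else pr 2 (snd_of x) else 0)"
    by (auto simp: comb_def fun_eq_iff a_def)
  then have "computable_on (nodes (comb A)) (succ2 (comb A))"
    by (simp only:) (intro computable_on_if_recfun recfun_intros a recfun_proj; simp)
  ultimately show ?thesis using wf_comb by (auto simp: computable_structure_def)
qed

section \<open>Punctual copies of the tree\<close>

text \<open>\<open>recfun\<close> does not record whether \<open>Mu\<close> occurs, so the closure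
  properties needed for punctual copies are proved anew with explicit \<open>mu_free\<close>
  codes.\<close>

lemma mu_free_const: "\<exists>p. mu_free p \<and> (\<forall>xs. rec_eval p xs c)"
proof (induction c)
  case 0
  show ?case by (intro exI[of _ Zero]) (auto intro: rec_eval.Zero)
next
  case (Suc c)
  then obtain p where "mu_free p" "\<And>xs. rec_eval p xs c" by blast
  then show ?case
    by (intro exI[of _ "Comp Succ [p]"]) (auto intro: rec_eval_Comp1 rec_eval.Succ)
qed

lemma primitive_recursive_comp:
  assumes "primitive_recursive f" "primitive_recursive g"
  shows "primitive_recursive (\<lambda>x. f (g x))"
proof -
  obtain p q where "mu_free p" "mu_free q" "\<And>x. rec_eval p [x] (f x)" "\<And>x. rec_eval q [x] (g x)"
    using assms by (auto simp: primitive_recursive_def)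
  then show ?thesis unfolding primitive_recursive_def
    by (intro exI[of _ "Comp p [q]"]) (auto intro: rec_eval_Comp1)
qed

lemma primitive_recursive_funpow:
  assumes "primitive_recursive f"
  shows "primitive_recursive (\<lambda>n. (f ^^ n) c)"
proof -
  obtain p where p: "mu_free p" "\<And>x. rec_eval p [x] (f x)"
    using assms by (auto simp: primitive_recursive_def)
  obtain q where q: "mu_free q" "\<And>xs. rec_eval q xs c" using mu_free_const by blast
  \<comment> \<open>The step receives \<open>[n, y]\<close> with \<open>y\<close> the previous
    value; \<open>Proj 1\<close> selects \<open>y\<close>.\<close>
  have "rec_eval (PrimRec q (Comp p [Proj 1])) [n] ((f ^^ n) c)" for n
  proof (induction n)
    case 0
    show ?case using q by (auto intro: rec_eval.PrimRec_0)
  next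
    case (Suc n)
    have "rec_eval (Proj 1) [n, (f ^^ n) c] ((f ^^ n) c)"
      using rec_eval.Proj[of 1 "[n, (f ^^ n) c]"] by simp
    then have "rec_eval (Comp p [Proj 1]) [n, (f ^^ n) c] ((f ^^ Suc n) c)"
      using p(2) by (auto intro: rec_eval_Comp1)
    with Suc show ?case by (rule rec_eval.PrimRec_Suc)
  qed
  then show ?thesis unfolding primitive_recursive_def
    using p(1) q(1) by (intro exI[of _ "PrimRec q (Comp p [Proj 1])"]) auto
qed

lemma primitive_recursive_case_nat:
  assumes "primitive_recursive f"
  shows "primitive_recursive (\<lambda>n. case n of 0 \<Rightarrow> c | Suc m \<Rightarrow> f m)"
proof -
  obtain p where p: "mu_free p" "\<And>x. rec_eval p [x] (f x)"
    using assms by (auto simp: primitive_recursive_def)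
  obtain q where q: "mu_free q" "\<And>xs. rec_eval q xs c" using mu_free_const by blast
  have "rec_eval (PrimRec q (Comp p [Proj 0])) [n] (case n of 0 \<Rightarrow> c | Suc m \<Rightarrow> f m)" for n
  proof (induction n)
    case 0
    show ?case using q by (auto intro: rec_eval.PrimRec_0)
  next
    case (Suc n)
    let ?y = "case n of 0 \<Rightarrow> c | Suc m \<Rightarrow> f m"
    have "rec_eval (Proj 0) [n, ?y] n"
      using rec_eval.Proj[of 0 "[n, ?y]"] by simp
    then have "rec_eval (Comp p [Proj 0]) [n, ?y] (f n)"
      using p(2) by (auto intro: rec_eval_Comp1)
    with Suc show ?case by (auto intro: rec_eval.PrimRec_Suc)
  qed
  then show ?thesis unfolding primitive_recursive_def
    using p(1) q(1) by (intro exI[of _ "PrimRec q (Comp p [Proj 0])"]) auto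
qed

lemma primitive_recursive_const: "primitive_recursive (\<lambda>_. c)"
  using mu_free_const[of c] unfolding primitive_recursive_def by blast

text \<open>The number \<open>e\<close> is fixed, so comparison with it takes \<open>e + 1\<close>
  nested case distinctions, one for each induction step and one for the base.\<close>

lemma primitive_recursive_neq: "primitive_recursive (\<lambda>n. if n \<noteq> e then 1 else 0)"
proof (induction e)
  case 0
  have "(\<lambda>n::nat. if n \<noteq> 0 then 1 else (0::nat)) = (\<lambda>n. case n of 0 \<Rightarrow> 0 | Suc m \<Rightarrow> 1)"
    by (auto simp: fun_eq_iff split: nat.split)
  then show ?case
    using primitive_recursive_case_nat[OF primitive_recursive_const[of 1], of 0] by (simp only:)
next
  case (Suc e)
  have "(\<lambda>n. if n \<noteq> Suc e then 1 else (0::nat)) =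
    (\<lambda>n. case n of 0 \<Rightarrow> 1 | Suc m \<Rightarrow> if m \<noteq> e then 1 else 0)"
    by (auto simp: fun_eq_iff split: nat.split)
  then show ?case using primitive_recursive_case_nat[OF Suc, of 1] by (simp only:)
qed

lemma punctual_comb_imp_primitive_recursive:
  assumes "punctual B" "isomorphic (comb A) B"
  shows "primitive_recursive (\<lambda>n. if n \<in> A then 1 else 0)"
proof -
  obtain h where bij: "bij_betw h (nodes (comb A)) (nodes B)"
    and h1: "\<And>x. x \<in> nodes (comb A) \<Longrightarrow> h (succ1 (comb A) x) = succ1 B (h x)"
    and h2: "\<And>x. x \<in> nodes (comb A) \<Longrightarrow> h (succ2 (comb A) x) = succ2 B (h x)"
    and he: "h (empty_node (comb A)) = empty_node B" and hr: "h (root (comb A)) = root B"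
    using assms(2) by (auto simp: isomorphic_def)
  have spine: "pr 1 n \<in> nodes (comb A)" for n by (simp add: comb_def)
  have pos: "(succ1 B ^^ n) (root B) = h (pr 1 n)" for n
  proof (induction n)
    case 0
    show ?case using hr by (simp add: comb_def)
  next
    case (Suc n)
    then show ?case using h1[OF spine[of n]] by (simp add: comb_def)
  qed
  have "succ2 B ((succ1 B ^^ n) (root B)) \<noteq> empty_node B \<longleftrightarrow> n \<in> A" for n
  proof -
    have mem: "succ2 (comb A) (pr 1 n) \<in> nodes (comb A)" "empty_node (comb A) \<in> nodes (comb A)"
      using wf_comb[of A] spine by (auto simp: wf_structure_def)
    have "succ2 B ((succ1 B ^^ n) (root B)) = h (succ2 (comb A) (pr 1 n))"
      using pos h2[OF spine] by simp
    \<comment> \<open>Injectivity of \<open>h\<close> lets the copy detect a missing leaf: only the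
      empty node is mapped to the empty node of \<open>B\<close>.\<close>
    moreover have "h (succ2 (comb A) (pr 1 n)) = h (empty_node (comb A)) \<longleftrightarrow>
        succ2 (comb A) (pr 1 n) = empty_node (comb A)"
      using mem by (rule inj_on_eq_iff[OF bij_betw_imp_inj_on[OF bij]])
    moreover have "succ2 (comb A) (pr 1 n) = empty_node (comb A) \<longleftrightarrow> n \<notin> A"
      by (simp add: comb_def)
    ultimately show ?thesis using he by simp
  qed
  moreover have "primitive_recursive (succ1 B)" "primitive_recursive (succ2 B)"
    using assms(1) by (simp_all add: punctual_def)
  then have "primitive_recursive
      (\<lambda>n. if succ2 B ((succ1 B ^^ n) (root B)) \<noteq> empty_node B then 1 else 0)"
    using primitive_recursive_comp[OF primitive_recursive_neq
        primitive_recursive_comp[OF _ primitive_recursive_funpow]] by blast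
  ultimately show ?thesis by simp
qed

theorem theorem27:
  shows "\<not> punctually_robust {A :: nat succ_structure. binary_successor_tree A \<and> infinite (nodes A)} \<and>
    (\<exists>A :: nat succ_structure. binary_successor_tree A \<and> infinite (nodes A) \<and> computable_structure A \<and>
      \<not> (\<exists>B. binary_successor_tree B \<and> punctual B \<and> isomorphic A B))"
proof -
  have "computable_structure (comb diag)"
    by (intro computable_structure_comb recfun_diag recfun_proj) simp
  \<comment> \<open>\<open>punctually_robust\<close> quantifies over all punctual \<open>B\<close>;
    the second conjunct is the special case where \<open>B\<close> is a tree.\<close>
  moreover have "\<not> (\<exists>B. punctual B \<and> isomorphic (comb diag) B)"
    using punctual_comb_imp_primitive_recursive diag_not_primitive_recursive by blast
  ultimately show ?thesis
    using binary_successor_tree_comb[of diag] infinite_comb[of diag]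
    unfolding punctually_robust_def by blast
qed

end
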